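(* Let $n\ge 2$ be an integer, let $\alpha\in\mathbb{R}$, $p>1$, and let $k\ge 2$ be an integer. Let $c_{\alpha,k,p}$ denote the best (i.e. largest) constant $c\ge 0$ such that $$\int_{\mathbb{R}^n}|x|^{\alpha}|\nabla^k u|^p\,dx\ \ge\ c\int_{\mathbb{R}^n}|x|^{\alpha-kp}|u|^p\,dx\qquad\text{for all } u\in C^k_{c,r}(\mathbb{R}^n\setminus\{0\}).$$ Then $$c_{\alpha,k,p}=\begin{cases}\displaystyle\prod_{h=1}^m|\gamma_{\alpha,2h}|^{p}&\text{if } k=2m \text{ is even},\\[2mm] \displaystyle|H_{\alpha}|^p\prod_{h=1}^m|\gamma_{\alpha,2h+1}|^{p}&\text{if } k=2m+1 \text{ is odd}.\end{cases}$$
   Context: $C^k_{c,r}(\mathbb{R}^n\setminus\{0\})$ is the space of radially symmetric functions in $C^k_c(\mathbb{R}^n\setminus\{0\})$. The operator $\nabla^k$ is defined by $\nabla^k=\Delta^m$ if $k=2m$ is even, and $\nabla^k=\nabla\Delta^m$ if $k=2m+1$ is odd. The constants are $$H_\alpha=\frac{n+\alpha}{p}-1,\qquad \gamma_{\alpha,h}=\left(\frac{n+\alpha}{p}-h\right)\left(n-2+h-\frac{n+\alpha}{p}\right)\quad (h\ge 2 \text{ an integer}).$$ *)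

theory Defs
  imports "HOL-Analysis.Analysis"
begin

definition partial_deriv :: "'n::finite \<Rightarrow> (real^'n \<Rightarrow> real) \<Rightarrow> real^'n \<Rightarrow> real" where
  "partial_deriv i f x = frechet_derivative f (at x) (axis i 1)"

definition gradient :: "(real^'n \<Rightarrow> real) \<Rightarrow> real^'n \<Rightarrow> real^'n::finite" where
  "gradient f x = (\<chi> i. partial_deriv i f x)"

definition laplacian :: "(real^'n::finite \<Rightarrow> real) \<Rightarrow> real^'n \<Rightarrow> real" where
  "laplacian f x = (\<Sum>i\<in>UNIV. partial_deriv i (partial_deriv i f) x)"

(* f is of class C^k on S; meant for open S only, since the derivatives are two-sided. *)
primrec Ck_on :: "nat \<Rightarrow> (real^'n::finite) set \<Rightarrow> (real^'n \<Rightarrow> real) \<Rightarrow> bool" where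
  "Ck_on 0 S f \<longleftrightarrow> continuous_on S f"
| "Ck_on (Suc k) S f \<longleftrightarrow>
     (\<forall>x\<in>S. f differentiable (at x)) \<and> (\<forall>i. Ck_on k S (partial_deriv i f))"

(* C^k_c(S) for open S. Its elements are represented by their extension by zero to the whole
   space: the support is closed in the whole space and contained in S. *)
definition Ck_compact :: "nat \<Rightarrow> (real^'n::finite) set \<Rightarrow> (real^'n \<Rightarrow> real) set" where
  "Ck_compact k S =
     {u. Ck_on k S u \<and> compact (closure {x. u x \<noteq> 0}) \<and> closure {x. u x \<noteq> 0} \<subseteq> S}"

definition radially_symmetric :: "(real^'n::finite \<Rightarrow> real) \<Rightarrow> bool" where
  "radially_symmetric u \<longleftrightarrow> (\<forall>x y. norm x = norm y \<longrightarrow> u x = u y)"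

definition Ck_compact_radial :: "nat \<Rightarrow> (real^'n::finite) set \<Rightarrow> (real^'n \<Rightarrow> real) set" where
  "Ck_compact_radial k S = {u \<in> Ck_compact k S. radially_symmetric u}"

(* The Euclidean length of nabla^k u at x. The operator nabla^k is scalar-valued for even k and
   vector-valued for odd k, so only its pointwise length has a type independent of k. *)
definition norm_nabla :: "nat \<Rightarrow> (real^'n::finite \<Rightarrow> real) \<Rightarrow> real^'n \<Rightarrow> real" where
  "norm_nabla k u x =
     (if even k then \<bar>(laplacian ^^ (k div 2)) u x\<bar>
      else norm (gradient ((laplacian ^^ (k div 2)) u) x))"

(* The first argument only fixes the dimension n = CARD('n). *)
definition admissible_constant ::
    "'n::finite itself \<Rightarrow> real \<Rightarrow> nat \<Rightarrow> real \<Rightarrow> real \<Rightarrow> bool" where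
  "admissible_constant _ \<alpha> k p c \<longleftrightarrow> 0 \<le> c \<and>
     (\<forall>u :: real^'n \<Rightarrow> real. u \<in> Ck_compact_radial k (UNIV - {0}) \<longrightarrow>
        (LINT x|lborel. norm x powr \<alpha> * norm_nabla k u x powr p)
          \<ge> c * (LINT x|lborel. norm x powr (\<alpha> - real k * p) * \<bar>u x\<bar> powr p))"

definition is_best_constant ::
    "'n::finite itself \<Rightarrow> real \<Rightarrow> nat \<Rightarrow> real \<Rightarrow> real \<Rightarrow> bool" where
  "is_best_constant T \<alpha> k p c \<longleftrightarrow>
     admissible_constant T \<alpha> k p c \<and> (\<forall>c'. admissible_constant T \<alpha> k p c' \<longrightarrow> c' \<le> c)"

definition hardy_H :: "nat \<Rightarrow> real \<Rightarrow> real \<Rightarrow> real" where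
  "hardy_H n p \<alpha> = (real n + \<alpha>) / p - 1"

definition rellich_gamma :: "nat \<Rightarrow> real \<Rightarrow> real \<Rightarrow> nat \<Rightarrow> real" where
  "rellich_gamma n p \<alpha> h =
     ((real n + \<alpha>) / p - real h) * (real n - 2 + real h - (real n + \<alpha>) / p)"

end

theory Submission
  imports Defs
begin

text \<open>
  Write \<open>t = - ln |x|\<close>. A radial function has the form \<open>u x = exp (b t) f t\<close> off the origin, and
  \<open>\<Delta> (exp (b t) f t) = exp ((b + 2) t) (D + b - (n - 2)) (D + b) f t\<close> with \<open>D = d/dt\<close>, while
  the gradient of \<open>exp (b t) f t\<close> has length \<open>exp ((b + 1) t) |(D + b) f t|\<close>. Since the measure
  \<open>dx\<close> becomes a multiple of \<open>exp (- n t) dt\<close>, the choice \<open>b = (n + \<alpha>) / p - k\<close> removes all weights and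
  the inequality turns into a bound \<open>\<integral> |Q(D) f|^p \<ge> c \<integral> |f|^p\<close> on the real line, where \<open>Q\<close> is a product
  of \<open>k\<close> factors \<open>X + c\<^sub>j\<close>. Each factor satisfies \<open>\<integral> |f' + c f|^p \<ge> |c|^p \<integral> |f|^p\<close>, because
  by convexity the integrand on the left is at least \<open>|c f|^p\<close> plus a multiple of the derivative of
  \<open>|f|^p\<close>. Testing with long plateaus shows that \<open>|Q(0)|^p\<close>, the product of the \<open>|c\<^sub>j|^p\<close>, is optimal.
\<close>

section \<open>Logarithmic polar coordinates\<close>

text \<open>The minus sign makes differentiation raise exponential weights: the Laplacian turns
  \<open>exp (b t)\<close> into a multiple of \<open>exp ((b + 2) t)\<close>. The origin, where
  \<open>ln\<close> carries no meaning, is a null set.\<close>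

definition neg_log_norm :: "'a::real_normed_vector \<Rightarrow> real" where
  "neg_log_norm x = - ln (norm x)"

lemma exp_neg_log_norm: "x \<noteq> 0 \<Longrightarrow> exp (c * neg_log_norm x) = norm x powr (- c)"
  by (simp add: neg_log_norm_def powr_def)

lemma neg_log_norm_measurable [measurable]:
  "(neg_log_norm :: 'a::euclidean_space \<Rightarrow> real) \<in> borel_measurable borel"
  unfolding neg_log_norm_def by measurable

lemma AE_lborel_nonzero: "AE x in lborel. (x::'a::euclidean_space) \<noteq> 0"
  by (rule AE_lborel_singleton)

text \<open>Up to the origin, \<open>neg_log_norm x > s\<close> describes the ball of radius
  \<open>exp (- s)\<close>, whose volume is also the tail of the stated density. Finite values on
  the half-lines determine a measure, so this takes the place of polar coordinates.\<close>

lemma distr_neg_log_norm: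
  "distr lborel borel (neg_log_norm :: 'a::euclidean_space \<Rightarrow> real) =
     density lborel (\<lambda>t. ennreal (DIM('a) * unit_ball_vol DIM('a) * exp (- real DIM('a) * t)))"
    (is "?M = ?N")
proof (rule measure_eqI_lessThan)
  let ?n = "real DIM('a)" and ?V = "unit_ball_vol (real DIM('a))"
  have M: "emeasure ?M {s<..} = ennreal (?V * exp (- ?n * s))" for s
  proof -
    have "emeasure ?M {s<..} = emeasure lborel (neg_log_norm -` {s<..} :: 'a set)"
      by (subst emeasure_distr) auto
    also have "\<dots> = emeasure lborel (ball (0::'a) (exp (- s)))"
    proof (rule emeasure_eq_AE)
      show "AE x in lborel. x \<in> (neg_log_norm -` {s<..} :: 'a set) \<longleftrightarrow> x \<in> ball 0 (exp (- s))"
        using AE_lborel_nonzero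
      proof eventually_elim
        case (elim x)
        then have "norm x < exp (- s) \<longleftrightarrow> ln (norm x) < - s"
          by (metis exp_less_cancel_iff exp_ln zero_less_norm_iff)
        then show ?case
          by (auto simp: neg_log_norm_def)
      qed
      show "neg_log_norm -` {s<..} \<in> sets (lborel :: 'a measure)"
        using measurable_sets[OF neg_log_norm_measurable, of "{s<..}"] by simp
    qed simp
    also have "\<dots> = ennreal (?V * exp (- s) ^ DIM('a))"
      by (simp add: emeasure_ball)
    also have "exp (- s) ^ DIM('a) = exp (- ?n * s)"
      by (simp flip: exp_of_nat_mult)
    finally show ?thesis .
  qed
  show "emeasure ?M {s<..} = emeasure ?N {s<..}" for s
  proof -
    have "emeasure ?N {s<..} = (\<integral>\<^sup>+t\<in>{s<..}. ennreal (?n * ?V * exp (- ?n * t)) \<partial>lborel)"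
      by (subst emeasure_density) auto
    also have "\<dots> = (\<integral>\<^sup>+t\<in>{s..}. ennreal (?n * ?V * exp (- ?n * t)) \<partial>lborel)"
      by (rule nn_integral_cong_AE, use AE_lborel_singleton[of s] in eventually_elim)
        (simp add: indicator_def)
    also have "\<dots> = ennreal (0 - - ?V * exp (- ?n * s))"
    proof (rule nn_integral_FTC_atLeast)
      show "((\<lambda>t. - ?V * exp (- ?n * t)) has_real_derivative ?n * ?V * exp (- ?n * t)) (at t)"
        for t by (auto intro!: derivative_eq_intros)
      have "filterlim (\<lambda>t. ?n * t) at_top at_top"
        by (rule filterlim_tendsto_pos_mult_at_top[OF tendsto_const]) (auto simp: filterlim_ident)
      then have "filterlim (\<lambda>t. - ?n * t) at_bot at_top"
        by (simp add: filterlim_uminus_at_bot)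
      then have "((\<lambda>t. exp (- ?n * t)) \<longlongrightarrow> 0) at_top"
        by (rule filterlim_compose[OF exp_at_bot])
      then show "((\<lambda>t. - ?V * exp (- ?n * t)) \<longlongrightarrow> 0) at_top"
        using tendsto_mult_right_zero by blast
    qed auto
    finally show ?thesis using M by simp
  qed
  show "emeasure ?M {s<..} < \<infinity>" for s
    unfolding M by simp
qed auto

text \<open>The factor \<open>exp (n t)\<close> in \<open>F\<close> cancels the density
  \<open>exp (- n t)\<close>. Continuity of \<open>g\<close> supplies measurability; the identity of
  Bochner integrals covers the nonintegrable case as well.\<close>

lemma integral_log_radial:
  fixes F :: "'a::euclidean_space \<Rightarrow> real"
  assumes F: "\<And>x. x \<noteq> 0 \<Longrightarrow> F x = exp (DIM('a) * neg_log_norm x) * g (neg_log_norm x)"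
    and g: "continuous_on UNIV g"
  shows "(LINT x|lborel. F x) = DIM('a) * unit_ball_vol DIM('a) * (LINT t|lborel. g t)"
proof -
  let ?n = "real DIM('a)" and ?V = "unit_ball_vol (real DIM('a))"
  have [measurable]: "g \<in> borel_measurable borel"
    using g by (rule borel_measurable_continuous_onI)
  \<comment> \<open>The value \<open>F 0\<close> is arbitrary, so measurability of \<open>F\<close>
    is read off from a case distinction at the origin.\<close>
  have "F = (\<lambda>x. if x = 0 then F 0 else exp (?n * neg_log_norm x) * g (neg_log_norm x))"
    by (rule ext) (use F in simp)
  moreover have "(\<lambda>x::'a. if x = 0 then F 0 else exp (?n * neg_log_norm x) * g (neg_log_norm x))
      \<in> borel_measurable borel"
    by measurable
  ultimately have [measurable]: "F \<in> borel_measurable borel"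
    by simp
  have "(LINT x|lborel. F x) = (LINT x|lborel. exp (?n * neg_log_norm x) * g (neg_log_norm (x::'a)))"
    by (rule integral_cong_AE) (use AE_lborel_nonzero F in \<open>auto elim!: eventually_mono\<close>)
  also have "\<dots> = (LINT t|distr lborel borel (neg_log_norm :: 'a \<Rightarrow> real). exp (?n * t) * g t)"
    by (subst integral_distr) auto
  also have "\<dots> = (LINT t|lborel. (?n * ?V * exp (- ?n * t)) * (exp (?n * t) * g t))"
    unfolding distr_neg_log_norm by (subst integral_real_density) auto
  also have "\<dots> = (LINT t|lborel. (?n * ?V) * g t)"
    by (intro Bochner_Integration.integral_cong) (auto simp: exp_minus)
  finally show ?thesis by simp
qed

section \<open>The inequality on the real line\<close>

primrec Ck_real :: "nat \<Rightarrow> (real \<Rightarrow> real) \<Rightarrow> bool" where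
  "Ck_real 0 f \<longleftrightarrow> continuous_on UNIV f"
| "Ck_real (Suc k) f \<longleftrightarrow> (\<forall>t. f differentiable (at t)) \<and> Ck_real k (deriv f)"

lemma Ck_real_has_deriv: "Ck_real (Suc k) f \<Longrightarrow> (f has_real_derivative deriv f t) (at t)"
  by (simp add: DERIV_deriv_iff_real_differentiable)

lemma Ck_real_SucI:
  assumes "\<And>t. (f has_real_derivative f' t) (at t)" and "Ck_real k f'"
  shows "Ck_real (Suc k) f"
proof -
  have "deriv f = f'"
    using assms(1) by (auto intro: DERIV_imp_deriv)
  then show ?thesis
    using assms by (auto simp: real_differentiable_def)
qed

lemma Ck_real_SucD: "Ck_real (Suc k) f \<Longrightarrow> Ck_real k f"
proof (induction k arbitrary: f)
  case 0
  then show ?case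
    by (auto intro!: continuous_at_imp_continuous_on dest!: differentiable_imp_continuous_within)
qed simp

lemma Ck_real_mono: "Ck_real k f \<Longrightarrow> j \<le> k \<Longrightarrow> Ck_real j f"
proof (induction k)
  case (Suc k)
  then show ?case
    using Ck_real_SucD le_Suc_eq by blast
qed simp

lemma Ck_real_continuous: "Ck_real k f \<Longrightarrow> continuous_on UNIV f"
  using Ck_real_mono[of k f 0] by simp

lemma Ck_real_const: "Ck_real k (\<lambda>_. c)"
proof (induction k arbitrary: c)
  case (Suc k)
  show ?case by (rule Ck_real_SucI[of _ "\<lambda>_. 0"]) (auto intro: Suc)
qed simp

lemma Ck_real_add: "Ck_real k f \<Longrightarrow> Ck_real k g \<Longrightarrow> Ck_real k (\<lambda>t. f t + g t)"
proof (induction k arbitrary: f g)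
  case (Suc k)
  show ?case
    by (rule Ck_real_SucI[of _ "\<lambda>t. deriv f t + deriv g t"])
      (use Suc in \<open>auto intro!: derivative_eq_intros Ck_real_has_deriv simp del: Ck_real.simps(2)\<close>, use Suc in auto)
qed (auto intro: continuous_intros)

lemma Ck_real_mult: "Ck_real k f \<Longrightarrow> Ck_real k g \<Longrightarrow> Ck_real k (\<lambda>t. f t * g t)"
proof (induction k arbitrary: f g)
  case (Suc k)
  have "Ck_real k (\<lambda>t. deriv f t * g t + deriv g t * f t)"
    using Suc by (intro Ck_real_add Suc.IH) (auto intro: Ck_real_SucD)
  then show ?case
    by (rule Ck_real_SucI[rotated]) (intro DERIV_mult Ck_real_has_deriv[of k] Suc.prems)
qed (auto intro: continuous_intros)

lemma Ck_real_cmult: "Ck_real k f \<Longrightarrow> Ck_real k (\<lambda>t. c * f t)"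
  by (intro Ck_real_mult Ck_real_const)

lemma Ck_real_diff: "Ck_real k f \<Longrightarrow> Ck_real k g \<Longrightarrow> Ck_real k (\<lambda>t. f t - g t)"
  using Ck_real_add[of k f "\<lambda>t. - 1 * g t"] Ck_real_cmult[of k g "-1"] by simp

lemma Ck_real_inverse:
  "Ck_real k f \<Longrightarrow> (\<And>t. f t \<noteq> 0) \<Longrightarrow> Ck_real k (\<lambda>t. inverse (f t))"
proof (induction k)
  case (Suc k)
  have "Ck_real k (\<lambda>t. - 1 * (inverse (f t) * deriv f t * inverse (f t)))"
    using Suc by (intro Ck_real_cmult Ck_real_mult Suc.IH) (auto intro: Ck_real_SucD)
  then show ?case
    by (rule Ck_real_SucI[rotated])
      (use Suc.prems in \<open>auto intro!: derivative_eq_intros Ck_real_has_deriv simp del: Ck_real.simps(2)\<close>)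
qed (auto intro: continuous_intros)

lemma Ck_real_exp: "Ck_real k (\<lambda>t. exp (c * t))"
proof (induction k)
  case (Suc k)
  then show ?case
    by (intro Ck_real_SucI[OF _ Ck_real_cmult[of k _ c]]) (auto intro!: derivative_eq_intros)
qed (auto intro: continuous_intros)

lemma DERIV_affine_compose:
  assumes "Ck_real (Suc k) f"
  shows "((\<lambda>t. f (c * t + a)) has_real_derivative c * deriv f (c * t + a)) (at t)"
proof -
  have "((\<lambda>t. c * t + a) has_real_derivative c) (at t)"
    by (auto intro!: derivative_eq_intros)
  from DERIV_chain2[OF Ck_real_has_deriv[OF assms] this] show ?thesis
    by (rule DERIV_cong) simp
qed

lemma Ck_real_affine: "Ck_real k f \<Longrightarrow> Ck_real k (\<lambda>t. f (c * t + a))"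
proof (induction k arbitrary: f)
  case (Suc k)
  then show ?case
    using Ck_real_SucI[OF DERIV_affine_compose[of k f c a] Ck_real_cmult[OF Suc.IH]] by simp
qed (auto intro!: continuous_intros elim: continuous_on_compose2)

text \<open>Finite smoothness suffices for the cutoffs, so truncated powers replace the usual smooth
  bump. The derivative is a multiple of the truncated power one degree lower, also at
  \<open>0\<close>, where the difference quotient is at most \<open>|h| ^ Suc k\<close>.\<close>

lemma Ck_real_max_power: "Ck_real k (\<lambda>t. max 0 t ^ Suc k)"
proof (induction k)
  case (Suc k)
  let ?f = "\<lambda>t::real. max 0 t ^ Suc (Suc k)"
  have "(?f has_real_derivative real (k + 2) * max 0 t ^ Suc k) (at t)" for t :: real
  proof -
    consider "t > 0" | "t < 0" | "t = 0" by linarith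
    then show ?thesis
    proof cases
      case 1
      have "((\<lambda>t. t ^ Suc (Suc k)) has_real_derivative real (k + 2) * t ^ Suc k) (at t)"
        using DERIV_pow[of "Suc (Suc k)" t] by simp
      then have "(?f has_real_derivative (k + 2) * t ^ Suc k) (at t)"
        by (rule has_field_derivative_transform_within_open[of _ _ _ "{0<..}"]) (use 1 in auto)
      then show ?thesis using 1 by simp
    next
      case 2
      have "((\<lambda>t. 0) has_real_derivative 0) (at t)" by simp
      then have "(?f has_real_derivative 0) (at t)"
        by (rule has_field_derivative_transform_within_open[of _ _ _ "{..<0}"]) (use 2 in auto)
      then show ?thesis using 2 by simp
    next
      case 3
      have "((\<lambda>h. ?f h / h) \<longlongrightarrow> 0) (at 0)"
      proof (rule Lim_null_comparison)
        have "norm (?f h / h) \<le> \<bar>h\<bar> ^ Suc k" for h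
          by (cases "h > 0") (auto simp: abs_mult mult_nonpos_nonneg)
        then show "\<forall>\<^sub>F h in at 0. norm (?f h / h) \<le> \<bar>h\<bar> ^ Suc k" by simp
        show "((\<lambda>h::real. \<bar>h\<bar> ^ Suc k) \<longlongrightarrow> 0) (at 0)"
          by (rule tendsto_eq_intros refl | simp)+
      qed
      then show ?thesis using 3 by (simp add: DERIV_def)
    qed
  qed
  then show ?case
    using Ck_real_SucI[OF _ Ck_real_cmult[OF Suc]] by blast
qed (auto intro!: continuous_intros)

text \<open>The step is \<open>A / (A + B)\<close> with truncated powers \<open>A\<close>, vanishing
  for \<open>t <= 0\<close>, and \<open>B\<close>, vanishing for \<open>t >= 1\<close>. They never
  vanish together, so the denominator is positive.\<close>

lemma smooth_step_exists:
  obtains s where "Ck_real k s" "\<And>t. t \<le> 0 \<Longrightarrow> s t = 0" "\<And>t. t \<ge> 1 \<Longrightarrow> s t = (1::real)"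
proof (rule that)
  let ?A = "\<lambda>t::real. max 0 t ^ Suc k" and ?B = "\<lambda>t::real. max 0 (-1 * t + 1) ^ Suc k"
  let ?s = "\<lambda>t. ?A t * inverse (?A t + ?B t)"
  have B: "Ck_real k ?B"
    by (rule Ck_real_affine[OF Ck_real_max_power])
  have "?A t + ?B t > 0" for t
    by (cases "t > 0") (auto intro!: add_pos_nonneg)
  then have "?A t + ?B t \<noteq> 0" for t
    by (metis less_irrefl)
  then show "Ck_real k ?s"
    by (intro Ck_real_mult Ck_real_inverse Ck_real_add B Ck_real_max_power)
  show "?s t = 0" if "t \<le> 0" for t using that by simp
  show "?s t = 1" if "t \<ge> 1" for t using that by (simp add: field_simps)
qed

section \<open>Constant-coefficient operators as products of factors \<open>D + c\<close>\<close>

definition shifted_deriv :: "real \<Rightarrow> (real \<Rightarrow> real) \<Rightarrow> real \<Rightarrow> real" where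
  "shifted_deriv c f t = deriv f t + c * f t"

lemma shifted_deriv_Ck_real: "Ck_real (Suc k) f \<Longrightarrow> Ck_real k (shifted_deriv c f)"
  unfolding shifted_deriv_def [abs_def]
  by (intro Ck_real_add Ck_real_cmult) (auto intro: Ck_real_SucD)

lemma foldr_shifted_deriv_Ck_real:
  "Ck_real (k + length cs) f \<Longrightarrow> Ck_real k (foldr shifted_deriv cs f)"
  by (induction cs arbitrary: k) (auto intro: shifted_deriv_Ck_real simp del: Ck_real.simps)

text \<open>\<open>D\<close> kills constants, so each factor acts as multiplication by its
  \<open>c\<close>. With \<open>a = 0\<close> this shows that supports do not grow; with
  \<open>a = 1\<close> it gives the value \<open>Q(0)\<close> on plateaus.\<close>

lemma foldr_shifted_deriv_locally_const:
  assumes "open S" and "\<And>t. t \<in> S \<Longrightarrow> f t = a" and "t \<in> S"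
  shows "foldr shifted_deriv cs f t = prod_list cs * a"
  using assms(3)
proof (induction cs arbitrary: t)
  case (Cons c cs)
  let ?g = "foldr shifted_deriv cs f"
  have "((\<lambda>_. prod_list cs * a) has_real_derivative 0) (at t)" by simp
  then have "(?g has_real_derivative 0) (at t)"
    by (rule has_field_derivative_transform_within_open[OF _ \<open>open S\<close> Cons.prems]) (simp add: Cons.IH)
  then have "deriv ?g t = 0" by (rule DERIV_imp_deriv)
  then show ?case
    using Cons by (simp add: shifted_deriv_def[of _ ?g])
qed (use assms in simp)

text \<open>Factors with constant coefficients are linear and commute with translations. The plateau
  test functions are differences of two translates of one step.\<close>

lemma foldr_shifted_deriv_diff_translate:
  assumes "Ck_real (k + length cs) f"
  shows "foldr shifted_deriv cs (\<lambda>t. f (t + a) - f (t + b)) =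
    (\<lambda>t. foldr shifted_deriv cs f (t + a) - foldr shifted_deriv cs f (t + b))"
  using assms
proof (induction cs arbitrary: k)
  case (Cons c cs)
  let ?g = "foldr shifted_deriv cs f"
  have g: "Ck_real (Suc k) ?g"
    using Cons.prems by (intro foldr_shifted_deriv_Ck_real) simp
  have "((\<lambda>t. ?g (t + a) - ?g (t + b)) has_real_derivative deriv ?g (t + a) - deriv ?g (t + b)) (at t)"
    for t using DERIV_affine_compose[OF g, of 1] by (auto intro: DERIV_diff)
  then have "deriv (\<lambda>t. ?g (t + a) - ?g (t + b)) = (\<lambda>t. deriv ?g (t + a) - deriv ?g (t + b))"
    by (auto intro: DERIV_imp_deriv)
  then show ?case
    using Cons.IH[of "Suc k"] Cons.prems
    by (auto simp: shifted_deriv_def[of _ ?g] shifted_deriv_def[of _ "\<lambda>t. ?g (t + a) - ?g (t + b)"]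
        algebra_simps simp del: Ck_real.simps)
qed simp

section \<open>Integrals of compactly supported functions and convexity of
  \<open>|s|^p\<close>\<close>

lemma
  fixes f :: "real \<Rightarrow> real"
  assumes f: "continuous_on UNIV f" and supp: "\<And>t. A < \<bar>t\<bar> \<Longrightarrow> f t = 0"
  shows integrable_compact_support: "integrable lborel f"
    and has_integral_compact_support: "(f has_integral (LINT t|lborel. f t)) {-A..A}"
proof -
  have "integrable lborel (\<lambda>t. indicator {-A..A} t *\<^sub>R f t)"
    by (intro borel_integrable_compact) (auto intro: continuous_on_subset[OF f])
  moreover have "(\<lambda>t. indicator {-A..A} t *\<^sub>R f t) = f"
    using supp by (force simp: indicator_def abs_le_iff)
  ultimately show *: "integrable lborel f" by simp
  have "(f has_integral (LINT t|lborel. f t)) UNIV"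
    by (rule has_integral_integral_lborel[OF *])
  moreover have "f t = 0" if "t \<notin> {-A..A}" for t
    using that supp[of t] by (auto simp: abs_if split: if_splits)
  ultimately show "(f has_integral (LINT t|lborel. f t)) {-A..A}"
    using has_integral_restrict_UNIV[of "{-A..A}" f]
    by (smt (verit) has_integral_cong)
qed

text \<open>Splitting into powers of the positive and negative parts removes the jump of
  \<open>sgn\<close> at \<open>0\<close>. With \<open>q = p - 1\<close> this is the derivative of
  \<open>|s|^p\<close> up to the factor \<open>p\<close>.\<close>

lemma continuous_on_signed_powr:
  assumes "(q::real) > 0"
  shows "continuous_on UNIV (\<lambda>s. \<bar>s\<bar> powr q * sgn s)"
proof -
  have eq: "(\<lambda>s. \<bar>s\<bar> powr q * sgn s) = (\<lambda>s. max 0 s powr q - max 0 (- s) powr q)"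
    by (auto simp: sgn_if fun_eq_iff max_def)
  show ?thesis
    unfolding eq using assms by (intro continuous_intros continuous_on_powr') auto
qed

lemma has_real_derivative_abs_powr:
  assumes "p > 1"
  shows "((\<lambda>s. \<bar>s\<bar> powr p) has_real_derivative p * (\<bar>s\<bar> powr (p - 1) * sgn s)) (at s)"
proof -
  consider "s > 0" | "s < 0" | "s = 0" by linarith
  then show ?thesis
  proof cases
    case 1
    then have "((\<lambda>s. s powr p) has_real_derivative p * (\<bar>s\<bar> powr (p - 1) * sgn s)) (at s)"
      by (auto intro!: derivative_eq_intros)
    then show ?thesis
      by (rule has_field_derivative_transform_within_open[of _ _ _ "{0<..}"]) (use 1 in auto)
  next
    case 2
    then have "((\<lambda>s. (- s) powr p) has_real_derivative p * (\<bar>s\<bar> powr (p - 1) * sgn s)) (at s)"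
      by (auto intro!: derivative_eq_intros)
    then show ?thesis
      by (rule has_field_derivative_transform_within_open[of _ _ _ "{..<0}"]) (use 2 in auto)
  next
    case 3
    have "(\<lambda>h. \<bar>h\<bar> powr p / h) = (\<lambda>h::real. \<bar>h\<bar> powr (p - 1) * sgn h)"
      by (auto simp: fun_eq_iff powr_diff sgn_if)
    moreover have "isCont (\<lambda>h::real. \<bar>h\<bar> powr (p - 1) * sgn h) 0"
      using continuous_on_signed_powr[of "p - 1"] assms
      by (simp add: continuous_on_eq_continuous_at)
    ultimately show ?thesis
      using 3 by (simp add: DERIV_def isCont_def)
  qed
qed

text \<open>The derivative of \<open>|s|^p\<close> is increasing, so the function is convex and lies
  above its tangent at \<open>x\<close>, here evaluated at \<open>x + y\<close>.\<close>

lemma abs_powr_above_tangent: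
  fixes p x y :: real
  assumes "p > 1"
  shows "\<bar>x + y\<bar> powr p \<ge> \<bar>x\<bar> powr p + p * (\<bar>x\<bar> powr (p - 1) * sgn x) * y"
proof -
  have "convex_on UNIV (\<lambda>s::real. \<bar>s\<bar> powr p)"
  proof (rule convex_on_realI[OF _ has_real_derivative_abs_powr[OF assms]])
    fix x y :: real
    assume "x \<le> y"
    then have "\<bar>x\<bar> powr (p - 1) * sgn x \<le> \<bar>y\<bar> powr (p - 1) * sgn y"
      using assms powr_mono2[of "p - 1" x y] powr_mono2[of "p - 1" "- y" "- x"]
      by (auto simp: sgn_if add_nonneg_nonneg intro: order_trans[OF _ powr_ge_zero])
    then show "p * (\<bar>x\<bar> powr (p - 1) * sgn x) \<le> p * (\<bar>y\<bar> powr (p - 1) * sgn y)"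
      using assms by (intro mult_left_mono) auto
  qed simp
  from convex_on_imp_above_tangent[OF this, where c = x and x = "x + y", OF _ _ _ has_real_derivative_abs_powr[OF assms]]
  show ?thesis by simp
qed

section \<open>The sharp inequality for products of factors\<close>

definition compactly_supported :: "(real \<Rightarrow> real) \<Rightarrow> bool" where
  "compactly_supported f \<longleftrightarrow> (\<exists>A. \<forall>t. A < \<bar>t\<bar> \<longrightarrow> f t = 0)"

lemma compactly_supported_foldr:
  assumes "compactly_supported f"
  shows "compactly_supported (foldr shifted_deriv cs f)"
proof -
  obtain A where A: "\<And>t. A < \<bar>t\<bar> \<Longrightarrow> f t = 0"
    using assms by (auto simp: compactly_supported_def)
  have "open {t::real. A < \<bar>t\<bar>}"
    by (intro open_Collect_less continuous_intros)
  from foldr_shifted_deriv_locally_const[OF this, of f 0] A show ?thesis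
    by (auto simp: compactly_supported_def)
qed

lemma integral_shifted_deriv_ge:
  assumes f: "Ck_real (Suc 0) f" and "compactly_supported f" and p: "p > 1"
  shows "\<bar>c\<bar> powr p * (LINT t|lborel. \<bar>f t\<bar> powr p) \<le> (LINT t|lborel. \<bar>shifted_deriv c f t\<bar> powr p)"
proof -
  obtain A0 where A0: "\<And>t. A0 < \<bar>t\<bar> \<Longrightarrow> f t = 0"
    using assms(2) by (auto simp: compactly_supported_def)
  obtain A1 where A1: "\<And>t. A1 < \<bar>t\<bar> \<Longrightarrow> shifted_deriv c f t = 0"
    using compactly_supported_foldr[OF assms(2), of "[c]"] by (auto simp: compactly_supported_def)
  \<comment> \<open>Adding 1 makes \<open>f\<close> vanish at the endpoints \<open>A\<close> and
    \<open>-A\<close> themselves. There \<open>deriv f\<close> vanishes too, as the difference of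
    \<open>shifted_deriv c f\<close> and \<open>c * f\<close>.\<close>
  define A where "A = max 0 (max A0 A1) + 1"
  have A: "A > 0" "f t = 0" "deriv f t = 0" if "A \<le> \<bar>t\<bar>" for t
    using A0[of t] A1[of t] that by (auto simp: A_def shifted_deriv_def)
  have A_pos: "A > 0" by (simp add: A_def)
  define h where "h t = p * (\<bar>f t\<bar> powr (p - 1) * sgn (f t)) * deriv f t" for t
  note [continuous_intros] = continuous_on_powr'
  have cont: "continuous_on UNIV f" "continuous_on UNIV (deriv f)"
    using f Ck_real_continuous[OF f] by auto
  have "continuous_on UNIV (\<lambda>t. \<bar>f t\<bar> powr (p - 1) * sgn (f t))"
    using continuous_on_compose2[OF continuous_on_signed_powr[of "p - 1"] cont(1)] p by simp
  then have cont_h: "continuous_on UNIV h"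
    unfolding h_def by (rule continuous_on_mult[OF continuous_on_mult[OF continuous_on_const] cont(2)])
  have cont_f: "continuous_on UNIV (\<lambda>t. \<bar>f t\<bar> powr p)"
    using p by (intro continuous_intros cont) auto
  have cont_s: "continuous_on UNIV (\<lambda>t. \<bar>shifted_deriv c f t\<bar> powr p)"
    using p unfolding shifted_deriv_def by (intro continuous_intros cont) auto
  note int_f = integrable_compact_support[OF cont_f, of A]
    and int_h = integrable_compact_support[OF cont_h, of A]
    and int_s = integrable_compact_support[OF cont_s, of A]
  have int: "integrable lborel (\<lambda>t. \<bar>f t\<bar> powr p)" "integrable lborel h"
      "integrable lborel (\<lambda>t. \<bar>shifted_deriv c f t\<bar> powr p)"
    by ((rule int_f int_h int_s, simp add: A h_def shifted_deriv_def)+)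
  have h_FTC: "(h has_integral (\<bar>f A\<bar> powr p - \<bar>f (-A)\<bar> powr p)) {-A..A}"
  proof (rule fundamental_theorem_of_calculus)
    fix t
    have "((\<lambda>t. \<bar>f t\<bar> powr p) has_real_derivative h t) (at t)"
      unfolding h_def
      by (rule DERIV_chain2[OF has_real_derivative_abs_powr[OF p] Ck_real_has_deriv[OF f]])
    then show "((\<lambda>t. \<bar>f t\<bar> powr p) has_vector_derivative h t) (at t within {-A..A})"
      using has_field_derivative_at_within has_real_derivative_iff_has_vector_derivative by blast
  qed (use A_pos in simp)
  \<comment> \<open>Since \<open>h\<close> is the derivative of \<open>|f|^p\<close>, the
    fundamental theorem evaluates its integral by boundary values, which are zero; uniqueness of the
    gauge integral carries this over to the Lebesgue integral.\<close>
  have "(h has_integral (LINT t|lborel. h t)) {-A..A}"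
    by (rule has_integral_compact_support[OF cont_h]) (simp add: A h_def)
  from has_integral_unique[OF this h_FTC] have h0: "(LINT t|lborel. h t) = 0"
    using A(2)[of A] A(2)[of "-A"] A_pos p by simp
  \<comment> \<open>The tangent is taken at \<open>c * f t\<close> with increment
    \<open>deriv f t\<close>; its linear term is a constant multiple of \<open>h t\<close> and drops
    out on integration.\<close>
  have "\<bar>c\<bar> powr p * \<bar>f t\<bar> powr p + (\<bar>c\<bar> powr (p - 1) * sgn c) * h t
      \<le> \<bar>shifted_deriv c f t\<bar> powr p" for t
    using abs_powr_above_tangent[OF p, of "c * f t" "deriv f t"]
    by (simp add: shifted_deriv_def h_def abs_mult powr_mult sgn_mult algebra_simps)
  then have "(LINT t|lborel. \<bar>c\<bar> powr p * \<bar>f t\<bar> powr p + (\<bar>c\<bar> powr (p - 1) * sgn c) * h t)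
      \<le> (LINT t|lborel. \<bar>shifted_deriv c f t\<bar> powr p)"
    by (intro integral_mono int Bochner_Integration.integrable_add integrable_mult_right)
  then show ?thesis
    using int h0 by simp
qed

text \<open>The head of the list is the outermost factor. It is peeled off by the one-factor bound,
  applied to the inner product, which is still C^1 and compactly supported.\<close>

lemma integral_foldr_shifted_deriv_ge:
  assumes "Ck_real (length cs) f" and "compactly_supported f" and "p > 1"
  shows "\<bar>prod_list cs\<bar> powr p * (LINT t|lborel. \<bar>f t\<bar> powr p)
    \<le> (LINT t|lborel. \<bar>foldr shifted_deriv cs f t\<bar> powr p)"
  using assms(1)
proof (induction cs)
  case (Cons c cs)
  let ?g = "foldr shifted_deriv cs f"
  have "\<bar>c\<bar> powr p * (\<bar>prod_list cs\<bar> powr p * (LINT t|lborel. \<bar>f t\<bar> powr p))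
      \<le> \<bar>c\<bar> powr p * (LINT t|lborel. \<bar>?g t\<bar> powr p)"
    using Cons by (intro mult_left_mono Cons.IH) (auto intro: Ck_real_SucD)
  also have "\<dots> \<le> (LINT t|lborel. \<bar>shifted_deriv c ?g t\<bar> powr p)"
    using Cons.prems assms
    by (intro integral_shifted_deriv_ge foldr_shifted_deriv_Ck_real compactly_supported_foldr) auto
  finally show ?case
    by (simp add: abs_mult powr_mult mult.assoc)
qed simp

text \<open>For \<open>c >= 0\<close>, a plateau of length \<open>N\<close> makes the left side at
  least \<open>c * N\<close>. On the right, the operator multiplies the plateau by
  \<open>prod_list cs\<close>, and the two ramps contribute an amount bounded independently of
  \<open>N\<close>. Large \<open>N\<close> forces the claim.\<close>

lemma foldr_shifted_deriv_constant_sharp: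
  assumes ineq: "\<And>f. Ck_real (length cs) f \<Longrightarrow> compactly_supported f \<Longrightarrow>
      c * (LINT t|lborel. \<bar>f t\<bar> powr p) \<le> (LINT t|lborel. \<bar>foldr shifted_deriv cs f t\<bar> powr p)"
    and p: "p > 0"
  shows "c \<le> \<bar>prod_list cs\<bar> powr p"
proof (cases "c \<ge> 0")
  case True
  let ?q = "prod_list cs"
  obtain s where s: "Ck_real (length cs) s" "\<And>t. t \<le> 0 \<Longrightarrow> s t = 0" "\<And>t. t \<ge> 1 \<Longrightarrow> s t = 1"
    using smooth_step_exists by blast
  define S where "S = foldr shifted_deriv cs s"
  have S_cont: "continuous_on UNIV S"
    using foldr_shifted_deriv_Ck_real[of 0 cs s] s(1) by (simp add: S_def)
  have S0: "S t = 0" if "t < 0" for t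
    using foldr_shifted_deriv_locally_const[of "{..<0}" s 0 t cs] s(2) that by (simp add: S_def)
  have S1: "S t = ?q" if "t > 1" for t
    using foldr_shifted_deriv_locally_const[of "{1<..}" s 1 t cs] s(3) that by (simp add: S_def)
  have "compact (S ` {0..1})"
    by (intro compact_continuous_image continuous_on_subset[OF S_cont]) auto
  then obtain B where "\<forall>y\<in>S ` {0..1}. norm y \<le> B"
    using compact_imp_bounded[of "S ` {0..1}"] unfolding bounded_iff by blast
  then have B: "\<bar>S t\<bar> \<le> B" if "t \<in> {0..1}" for t
    using that by auto
  \<comment> \<open>The transformed plateau is a difference of two values of \<open>S\<close>, each
    of size at most \<open>max B |?q|\<close>, so \<open>M\<close> bounds its p-th power.\<close>
  define M where "M = (2 * max B \<bar>?q\<bar>) powr p"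
  have S_bound: "\<bar>S t\<bar> \<le> max B \<bar>?q\<bar>" for t
  proof -
    consider "t < 0" | "t \<in> {0..1}" | "t > 1" by fastforce
    then show ?thesis
      using B[of 0] B[of t] S0[of t] S1[of t] by cases (auto simp: le_max_iff_disj)
  qed
  have main: "c * N \<le> \<bar>?q\<bar> powr p * N + 2 * M" if N: "N \<ge> 0" for N :: real
  proof -
    \<comment> \<open>A plateau of length N whose two ramps do not depend on N.\<close>
    define f where "f t = s (t + 1) - s (t + - N)" for t
    let ?F = "foldr shifted_deriv cs f"
    have F: "?F t = S (t + 1) - S (t - N)" for t
      using foldr_shifted_deriv_diff_translate[of 0 cs s 1 "-N"] s(1)
      by (simp add: S_def f_def[abs_def])
    have f_Ck: "Ck_real (length cs) f"
      unfolding f_def[abs_def]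
      using Ck_real_affine[OF s(1), of 1 1] Ck_real_affine[OF s(1), of 1 "-N"] by (intro Ck_real_diff) simp_all
    have f_supp: "f t = 0" if "N + 1 < \<bar>t\<bar>" for t
    proof (cases "t < 0")
      case True
      then show ?thesis using that N by (simp add: f_def s(2))
    next
      case False
      then show ?thesis using that N by (simp add: f_def s(3))
    qed
    then have f_comp: "compactly_supported f"
      by (auto simp: compactly_supported_def)
    have f1: "f t = 1" if "0 \<le> t" "t \<le> N" for t
      using that s(2)[of "t - N"] s(3)[of "t + 1"] by (simp add: f_def)
    have f_cont: "continuous_on UNIV (\<lambda>t. \<bar>f t\<bar> powr p)"
      using p Ck_real_continuous[OF f_Ck] by (intro continuous_on_powr' continuous_intros) auto
    have F_cont: "continuous_on UNIV (\<lambda>t. \<bar>?F t\<bar> powr p)"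
      using p Ck_real_continuous[OF foldr_shifted_deriv_Ck_real[of 0 cs f]] f_Ck
      by (intro continuous_on_powr' continuous_intros) auto
    have F_supp: "?F t = 0" if "N + 1 < \<bar>t\<bar>" for t
    proof (cases "t < 0")
      case True
      then show ?thesis using that N by (simp add: F S0)
    next
      case False
      then show ?thesis using that N by (simp add: F S1)
    qed
    have ind: "integrable lborel (indicator {a..b} :: real \<Rightarrow> real)" for a b
      by (intro integrable_real_indicator) (auto simp: emeasure_lborel_Icc_eq)
    have "c * N \<le> c * (LINT t|lborel. \<bar>f t\<bar> powr p)"
    proof (rule mult_left_mono[OF _ True])
      have "N = (LINT t|lborel. indicator {0..N} t)"
        using N by simp
      also have "\<dots> \<le> (LINT t|lborel. \<bar>f t\<bar> powr p)"
        using integrable_compact_support[OF f_cont, of "N + 1"] f_supp f1 p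
        by (intro integral_mono ind) (auto simp: indicator_def)
      finally show "N \<le> (LINT t|lborel. \<bar>f t\<bar> powr p)" .
    qed
    also have "\<dots> \<le> (LINT t|lborel. \<bar>?F t\<bar> powr p)"
      by (rule ineq[OF f_Ck f_comp])
    also have "\<dots> \<le> (LINT t|lborel. \<bar>?q\<bar> powr p * indicator {0..N} t
        + M * indicator {-1..0} t + M * indicator {N..N+1} t)"
    proof (rule integral_mono)
      show "integrable lborel (\<lambda>t. \<bar>?F t\<bar> powr p)"
        using integrable_compact_support[OF F_cont, of "N + 1"] F_supp p by simp
      show "integrable lborel (\<lambda>t. \<bar>?q\<bar> powr p * indicator {0..N} t
        + M * indicator {-1..0} t + M * indicator {N..N+1} t)"
        by (intro Bochner_Integration.integrable_add integrable_mult_right ind)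
    next
      fix t
      let ?R = "\<bar>?q\<bar> powr p * indicator {0..N} t
        + M * indicator {-1..0} t + M * indicator {N..N+1} t"
      have M0: "M \<ge> 0" by (simp add: M_def)
      have R0: "?R \<ge> 0"
        using M0 by (intro add_nonneg_nonneg mult_nonneg_nonneg) auto
      consider "\<bar>?F t\<bar> = 0" | "0 \<le> t" "t \<le> N" "?F t = ?q" | "t \<in> {-1..0} \<or> t \<in> {N..N+1}"
      proof -
        \<comment> \<open>The ramps live on \<open>{-1..0}\<close> and \<open>{N..N+1}\<close>.
          Between them \<open>S (t + 1)\<close> has reached \<open>?q\<close> while
          \<open>S (t - N)\<close> is still zero; beyond \<open>N + 1\<close> both equal
          \<open>?q\<close> and cancel.\<close>
        consider "t < -1" | "t \<in> {-1..0}" | "0 < t" "t < N" | "t \<in> {N..N+1}" | "t > N + 1"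
          by fastforce
        then show ?thesis
          using that N by cases (auto simp: F S0 S1)
      qed
      then show "\<bar>?F t\<bar> powr p \<le> ?R"
      proof cases
        case 1
        then show ?thesis using R0 p by simp
      next
        case 2
        then show ?thesis using M0 by (simp add: indicator_def)
      next
        case 3
        have "\<bar>?F t\<bar> \<le> 2 * max B \<bar>?q\<bar>"
          using S_bound[of "t + 1"] S_bound[of "t - N"] unfolding F by linarith
        then have "\<bar>?F t\<bar> powr p \<le> M"
          unfolding M_def using p by (intro powr_mono2) auto
        also have "M \<le> ?R"
          using 3 M0 by (auto simp: indicator_def)
        finally show ?thesis .
      qed
    qed
    also have "\<dots> = \<bar>?q\<bar> powr p * N + 2 * M"
      using N by (subst Bochner_Integration.integral_add; simp)+
    finally show ?thesis .
  qed
  show ?thesis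
  proof (rule ccontr)
    assume "\<not> c \<le> \<bar>?q\<bar> powr p"
    then have d: "c - \<bar>?q\<bar> powr p > 0" by simp
    have "M \<ge> 0" by (simp add: M_def)
    \<comment> \<open>This choice of \<open>N\<close>, multiplied by \<open>c - |?q|^p\<close>,
      gives \<open>2 * M + 1\<close>, which exceeds the allowed \<open>2 * M\<close>.\<close>
    then have "c * ((2 * M + 1) / (c - \<bar>?q\<bar> powr p))
        \<le> \<bar>?q\<bar> powr p * ((2 * M + 1) / (c - \<bar>?q\<bar> powr p)) + 2 * M"
      using d by (intro main) simp
    then have "(c - \<bar>?q\<bar> powr p) * ((2 * M + 1) / (c - \<bar>?q\<bar> powr p)) \<le> 2 * M"
      by (simp only: left_diff_distrib)
    then show False using d by simp
  qed
next
  case False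
  then show ?thesis
    using powr_ge_zero[of "\<bar>prod_list cs\<bar>" p] by linarith
qed

section \<open>Radial functions\<close>

lemma partial_deriv_eqI: "(f has_derivative f') (at x) \<Longrightarrow> partial_deriv i f x = f' (axis i 1)"
  by (simp add: partial_deriv_def frechet_derivative_at[symmetric])

lemma has_derivative_cong_open:
  assumes "open S" "x \<in> S" "\<And>y. y \<in> S \<Longrightarrow> f y = g y"
  shows "(f has_derivative f') (at x) \<longleftrightarrow> (g has_derivative f') (at x)"
  using has_derivative_transform_within_open[of f f' x UNIV S g]
    has_derivative_transform_within_open[of g f' x UNIV S f] assms by auto

text \<open>\<open>frechet_derivative\<close> is a choice made from the relation
  \<open>has_derivative\<close>, and that relation is local; the equality thus covers points without
  a derivative as well.\<close>

lemma partial_deriv_cong_open: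
  assumes "open S" "x \<in> S" "\<And>y. y \<in> S \<Longrightarrow> f y = g y"
  shows "partial_deriv i f x = partial_deriv i g x"
  unfolding partial_deriv_def frechet_derivative_def
  using has_derivative_cong_open[OF assms] by simp

lemma laplacian_cong_open:
  assumes "open S" "x \<in> S" "\<And>y. y \<in> S \<Longrightarrow> f y = g y"
  shows "laplacian f x = laplacian g x"
  unfolding laplacian_def
  by (intro sum.cong refl partial_deriv_cong_open[OF assms(1)] assms) auto

lemma Ck_on_cong:
  assumes "open S"
  shows "(\<And>x. x \<in> S \<Longrightarrow> f x = g x) \<Longrightarrow> Ck_on k S f \<longleftrightarrow> Ck_on k S g"
proof (induction k arbitrary: f g)
  case 0
  then show ?case by (simp cong: continuous_on_cong)
next
  case (Suc k)
  have "f differentiable at x \<longleftrightarrow> g differentiable at x" if "x \<in> S" for x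
    using has_derivative_cong_open[OF assms that Suc.prems] by (simp add: differentiable_def)
  moreover have "Ck_on k S (partial_deriv i f) \<longleftrightarrow> Ck_on k S (partial_deriv i g)" for i
    by (intro Suc.IH partial_deriv_cong_open[OF assms]) (use Suc.prems in auto)
  ultimately show ?case by simp
qed

text \<open>The explicit derivative is known only on \<open>S\<close>, while
  \<open>partial_deriv\<close> is total with arbitrary values elsewhere; \<open>Ck_on_cong\<close>
  bridges the two.\<close>

lemma Ck_on_SucI:
  assumes "open S" and "\<And>x. x \<in> S \<Longrightarrow> (f has_derivative f' x) (at x)"
    and "\<And>i. Ck_on k S (\<lambda>x. f' x (axis i 1))"
  shows "Ck_on (Suc k) S f"
proof -
  have "Ck_on k S (partial_deriv i f)" for i
    using assms(3)[of i] Ck_on_cong[OF assms(1), of "partial_deriv i f" "\<lambda>x. f' x (axis i 1)"]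
      partial_deriv_eqI[OF assms(2)] by auto
  then show ?thesis
    using assms(2) by (auto simp: differentiable_def)
qed

lemma Ck_on_SucD: "Ck_on (Suc k) S f \<Longrightarrow> Ck_on k S f"
proof (induction k arbitrary: f)
  case 0
  then show ?case
    by (auto intro!: continuous_at_imp_continuous_on differentiable_imp_continuous_within)
qed simp

lemma Ck_on_has_derivative:
  "Ck_on (Suc k) S f \<Longrightarrow> x \<in> S \<Longrightarrow> (f has_derivative frechet_derivative f (at x)) (at x)"
  by (simp add: frechet_derivative_works)

lemma Ck_on_add:
  assumes "open S"
  shows "Ck_on k S f \<Longrightarrow> Ck_on k S g \<Longrightarrow> Ck_on k S (\<lambda>x. f x + g x)"
proof (induction k arbitrary: f g)
  case (Suc k)
  have "Ck_on k S (\<lambda>x. frechet_derivative f (at x) (axis i 1) + frechet_derivative g (at x) (axis i 1))"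
    for i using Suc by (intro Suc.IH) (auto simp flip: partial_deriv_def)
  then show ?case
    by (rule Ck_on_SucI[OF assms, rotated])
      (intro has_derivative_add Ck_on_has_derivative[OF Suc.prems(1)] Ck_on_has_derivative[OF Suc.prems(2)])
qed (auto intro: continuous_intros)

lemma Ck_on_mult:
  assumes "open S"
  shows "Ck_on k S f \<Longrightarrow> Ck_on k S g \<Longrightarrow> Ck_on k S (\<lambda>x. f x * g x)"
proof (induction k arbitrary: f g)
  case (Suc k)
  have "Ck_on k S (\<lambda>x. f x * frechet_derivative g (at x) (axis i 1)
      + frechet_derivative f (at x) (axis i 1) * g x)" for i
    using Suc.prems by (intro Ck_on_add[OF assms] Suc.IH)
      (auto intro: Ck_on_SucD simp flip: partial_deriv_def simp del: Ck_on.simps, simp_all)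
  then show ?case
    by (rule Ck_on_SucI[OF assms, rotated])
      (intro has_derivative_mult Ck_on_has_derivative[OF Suc.prems(1)] Ck_on_has_derivative[OF Suc.prems(2)])
qed (auto intro: continuous_intros)

lemma Ck_on_const: "open S \<Longrightarrow> Ck_on k S (\<lambda>_. c)"
proof (induction k arbitrary: c)
  case (Suc k)
  show ?case
    by (rule Ck_on_SucI[where f' = "\<lambda>_ _. 0"]) (simp_all only: Suc has_derivative_const)
qed simp

lemma Ck_on_component:
  assumes "open S"
  shows "Ck_on k S (\<lambda>x. x $ i)"
proof (cases k)
  case 0
  then show ?thesis by (simp add: continuous_on_component)
next
  case (Suc j)
  show ?thesis
    unfolding Suc
    by (rule Ck_on_SucI[OF assms bounded_linear.has_derivative[OF bounded_linear_vec_nth has_derivative_ident]])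
      (rule Ck_on_const[OF assms])
qed

section \<open>Differentiation of functions of \<open>neg_log_norm\<close>\<close>

text \<open>Writing \<open>|x|^(-2)\<close> as \<open>exp (2 * neg_log_norm x)\<close> keeps partial
  derivatives of radial functions in the form of a function of \<open>neg_log_norm x\<close> times a
  coordinate.\<close>

lemma has_derivative_neg_log_norm:
  fixes x :: "'a::real_inner"
  assumes "x \<noteq> 0"
  shows "(neg_log_norm has_derivative (\<lambda>h. - exp (2 * neg_log_norm x) * (x \<bullet> h))) (at x)"
proof -
  have "exp (2 * neg_log_norm x) = inverse (norm x * norm x)"
    using exp_neg_log_norm[OF assms, of 2] assms by (simp add: powr_minus power2_eq_square)
  moreover have "((\<lambda>x. - ln (norm x)) has_derivative (\<lambda>h. - (h \<bullet> sgn x * inverse (norm x)))) (at x)"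
    using assms by (intro has_derivative_minus has_derivative_ln has_derivative_norm) simp_all
  ultimately show ?thesis
    unfolding neg_log_norm_def [abs_def]
    by (simp add: sgn_div_norm inner_commute divide_inverse mult_ac)
qed

lemma has_derivative_log_radial:
  fixes x :: "'a::real_inner"
  assumes "Ck_real (Suc k) W" and "x \<noteq> 0"
  shows "((\<lambda>x. W (neg_log_norm x)) has_derivative
    (\<lambda>h. (- deriv W (neg_log_norm x) * exp (2 * neg_log_norm x)) * (x \<bullet> h))) (at x)"
  using has_derivative_compose[OF has_derivative_neg_log_norm[OF assms(2)]
      Ck_real_has_deriv[OF assms(1), unfolded has_field_derivative_def]]
  by (simp add: mult.assoc)

text \<open>Each partial derivative is a coordinate times the radial function with profile
  \<open>- deriv W t * exp (2 * t)\<close>, which has one degree of smoothness less; hence the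
  induction over arbitrary \<open>W\<close>.\<close>

lemma Ck_on_log_radial:
  "Ck_real k W \<Longrightarrow> Ck_on k (UNIV - {0}) (\<lambda>x::real^'n. W (neg_log_norm x))"
proof (induction k arbitrary: W)
  case 0
  have "continuous_on (UNIV - {0}) (neg_log_norm :: real^'n \<Rightarrow> real)"
    unfolding neg_log_norm_def [abs_def] by (auto intro!: continuous_intros)
  then show ?case
    using 0 by (auto elim: continuous_on_compose2)
next
  case (Suc k)
  have "Ck_on k (UNIV - {0}) (\<lambda>x::real^'n. (- deriv W (neg_log_norm x) * exp (2 * neg_log_norm x)) * x $ i)"
    for i
    using Suc.prems Ck_real_cmult[of k "deriv W" "-1"]
    by (intro Ck_on_mult Ck_on_component Suc.IH[of "\<lambda>t. - deriv W t * exp (2 * t)"] Ck_real_mult Ck_real_exp)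
      auto
  then have "Ck_on k (UNIV - {0}) (\<lambda>x::real^'n.
      (- deriv W (neg_log_norm x) * exp (2 * neg_log_norm x)) * (x \<bullet> axis i 1))" for i
    by (simp add: inner_axis)
  then show ?case
    by (rule Ck_on_SucI[rotated 2]) (use has_derivative_log_radial[OF Suc.prems] in auto)
qed

text \<open>The ray is minus its own derivative, so differentiating \<open>u\<close> along it yields
  \<open>- exp (- t)\<close> times a partial derivative of \<open>u\<close> along the same ray, and
  the induction continues with that partial derivative.\<close>

lemma Ck_real_ray:
  fixes i :: "'n::finite"
  shows "Ck_on k (UNIV - {0}) u \<Longrightarrow> Ck_real k (\<lambda>t. u (exp (- t) *\<^sub>R axis i 1))"
proof (induction k arbitrary: u)
  case 0
  have r: "continuous_on UNIV (\<lambda>t. exp (- t) *\<^sub>R (axis i 1 :: real^'n))"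
    by (intro continuous_intros)
  have "continuous_on (UNIV - {0}) u"
    using 0 by simp
  from continuous_on_compose2[OF this r] show ?case
    by (simp add: image_subset_iff axis_eq_0_iff)
next
  case (Suc k)
  let ?r = "\<lambda>t. exp (- t) *\<^sub>R (axis i 1 :: real^'n)"
  have r: "?r t \<noteq> 0" for t by (simp add: axis_eq_0_iff)
  have "((\<lambda>t. u (?r t)) has_real_derivative - (exp (-1 * t)) * partial_deriv i u (?r t)) (at t)" for t
  proof -
    let ?D = "frechet_derivative u (at (?r t))"
    have D: "(u has_derivative ?D) (at (?r t))"
      using Suc.prems r by (intro Ck_on_has_derivative) auto
    have "(?r has_derivative (\<lambda>h. (- exp (- t) * h) *\<^sub>R axis i 1)) (at t)"
      by (auto intro!: derivative_eq_intros)
    from has_derivative_compose[OF this D]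
    have "((\<lambda>t. u (?r t)) has_derivative (\<lambda>h. (- exp (- t) * h) * ?D (axis i 1))) (at t)"
      unfolding linear_cmul[OF has_derivative_linear[OF D]] by simp
    then show ?thesis
      unfolding has_field_derivative_def partial_deriv_def
      by (rule has_derivative_eq_rhs) (simp add: fun_eq_iff)
  qed
  moreover have "Ck_real k (\<lambda>t. - (exp (-1 * t)) * partial_deriv i u (?r t))"
    using Suc Ck_real_cmult[OF Ck_real_mult[OF Ck_real_exp[of k "-1"], of "\<lambda>t. partial_deriv i u (?r t)"], of "-1"]
    by simp
  ultimately show ?case by (rule Ck_real_SucI)
qed

lemma shifted_deriv_diff: "shifted_deriv (c - d) f t = shifted_deriv c f t - d * f t"
  by (simp add: shifted_deriv_def algebra_simps)

text \<open>Conjugation by \<open>exp (b t)\<close> turns \<open>D\<close> into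
  \<open>D + b\<close>: this is how weights become shifts.\<close>

lemma deriv_exp_mult:
  assumes "Ck_real (Suc k) f"
  shows "deriv (\<lambda>t. exp (b * t) * f t) = (\<lambda>t. exp (b * t) * shifted_deriv b f t)"
proof
  fix t
  have "((\<lambda>t. exp (b * t) * f t) has_real_derivative exp (b * t) * shifted_deriv b f t) (at t)"
    using Ck_real_has_deriv[OF assms, of t]
    by (auto intro!: derivative_eq_intros simp: shifted_deriv_def algebra_simps)
  then show "deriv (\<lambda>t. exp (b * t) * f t) t = exp (b * t) * shifted_deriv b f t"
    by (rule DERIV_imp_deriv)
qed

lemma exp_2_neg_log_norm: "x \<noteq> 0 \<Longrightarrow> exp (2 * neg_log_norm x) * (norm x)\<^sup>2 = 1"
  using exp_neg_log_norm[of x 2] by (simp add: powr_minus powr_realpow)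

lemma partial_deriv_log_radial:
  fixes x :: "real^'n::finite"
  assumes "Ck_real (Suc k) W" and "x \<noteq> 0"
  shows "partial_deriv i (\<lambda>x. W (neg_log_norm x)) x =
    (- deriv W (neg_log_norm x) * exp (2 * neg_log_norm x)) * x $ i"
  using partial_deriv_eqI[OF has_derivative_log_radial[OF assms]] by (simp add: inner_axis)

lemma partial_deriv_mult:
  assumes "(f has_derivative f') (at x)" "(g has_derivative g') (at x)"
  shows "partial_deriv i (\<lambda>x. f x * g x) x = f x * g' (axis i 1) + f' (axis i 1) * g x"
  using partial_deriv_eqI[OF has_derivative_mult[OF assms]] by simp

text \<open>The second partial derivatives sum to \<open>n V - V'\<close>, because
  \<open>exp (2 t) |x|^2 = 1\<close>; substituting the profile \<open>V\<close> gives the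
  formula.\<close>

lemma laplacian_log_radial:
  fixes x :: "real^'n::finite"
  assumes W: "Ck_real 2 W" and x: "x \<noteq> 0"
  shows "laplacian (\<lambda>x. W (neg_log_norm x)) x = exp (2 * neg_log_norm x) *
    (deriv (deriv W) (neg_log_norm x) - (real CARD('n) - 2) * deriv W (neg_log_norm x))"
proof -
  let ?T = "neg_log_norm :: real^'n \<Rightarrow> real"
  \<comment> \<open>\<open>V\<close> is the profile of the gradient: the i-th partial derivative is
    \<open>V (?T x) * x $ i\<close>.\<close>
  define V where "V t = - deriv W t * exp (2 * t)" for t
  have W': "Ck_real (Suc (Suc 0)) W" "Ck_real (Suc 0) (deriv W)"
    using W by (simp_all add: numeral_2_eq_2)
  have V: "Ck_real (Suc 0) V"
    unfolding V_def [abs_def]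
    using Ck_real_cmult[OF W'(2), of "-1"] by (intro Ck_real_mult Ck_real_exp) simp
  have V': "deriv V t = - (deriv (deriv W) t + 2 * deriv W t) * exp (2 * t)" for t
    unfolding V_def [abs_def]
    by (rule DERIV_imp_deriv)
      (auto intro!: derivative_eq_intros Ck_real_has_deriv[OF W'(2)] simp: algebra_simps)
  have "partial_deriv i (partial_deriv i (\<lambda>x. W (?T x))) x =
      V (?T x) - deriv V (?T x) * exp (2 * ?T x) * (x $ i)\<^sup>2" for i
  proof -
    have "partial_deriv i (partial_deriv i (\<lambda>x. W (?T x))) x =
        partial_deriv i (\<lambda>x. V (?T x) * x $ i) x"
      by (rule partial_deriv_cong_open[of "- {0}"])
        (use x partial_deriv_log_radial[OF W'(1)] in \<open>auto simp: V_def\<close>)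
    also have "\<dots> = V (?T x) * axis i 1 $ i
        + (- deriv V (?T x) * exp (2 * ?T x)) * (x \<bullet> axis i 1) * x $ i"
      by (intro partial_deriv_mult has_derivative_log_radial[OF V x]
          bounded_linear.has_derivative[OF bounded_linear_vec_nth] has_derivative_ident)
    finally show ?thesis
      by (simp add: inner_axis power2_eq_square)
  qed
  then have "laplacian (\<lambda>x. W (?T x)) x =
      CARD('n) * V (?T x) - deriv V (?T x) * (exp (2 * ?T x) * (\<Sum>i\<in>UNIV. (x $ i)\<^sup>2))"
    by (simp add: laplacian_def sum_subtractf sum_distrib_left mult.assoc)
  also have "(\<Sum>i\<in>UNIV. (x $ i)\<^sup>2) = (norm x)\<^sup>2"
    by (simp add: norm_vec_def L2_set_def sum_nonneg)
  finally show ?thesis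
    unfolding exp_2_neg_log_norm[OF x] V' by (simp add: V_def algebra_simps)
qed

lemma norm_gradient_log_radial:
  fixes x :: "real^'n::finite"
  assumes "Ck_real (Suc k) W" and x: "x \<noteq> 0"
  shows "norm (gradient (\<lambda>x. W (neg_log_norm x)) x) =
    exp (neg_log_norm x) * \<bar>deriv W (neg_log_norm x)\<bar>"
proof -
  have "gradient (\<lambda>x. W (neg_log_norm x)) x =
      (- deriv W (neg_log_norm x) * exp (2 * neg_log_norm x)) *\<^sub>R x"
    using partial_deriv_log_radial[OF assms] by (simp add: gradient_def vec_eq_iff)
  moreover have "exp (2 * neg_log_norm x) * norm x = exp (neg_log_norm x)"
    using x exp_neg_log_norm[OF x, of 2] exp_neg_log_norm[OF x, of 1]
    by (simp add: powr_minus powr_realpow power2_eq_square)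
  ultimately show ?thesis
    by (simp add: abs_mult)
qed

section \<open>Iterated Laplacians and \<open>norm_nabla\<close> as products of factors\<close>

text \<open>\<open>d\<close> stands for \<open>n - 2\<close>. A Laplacian acting on the weight
  exponent \<open>b + 2 m\<close> contributes two factors, placed at the head because
  \<open>foldr\<close> applies the head last.\<close>

primrec laplacian_shifts :: "real \<Rightarrow> real \<Rightarrow> nat \<Rightarrow> real list" where
  "laplacian_shifts d b 0 = []"
| "laplacian_shifts d b (Suc m) = (b + 2 * real m - d) # (b + 2 * real m) # laplacian_shifts d b m"

text \<open>For odd \<open>k\<close> the final gradient contributes one factor, at the weight
  exponent reached after all Laplacians.\<close>

definition nabla_shifts :: "real \<Rightarrow> real \<Rightarrow> nat \<Rightarrow> real list" where
  "nabla_shifts d b k = (if even k then laplacian_shifts d b (k div 2)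
     else (b + 2 * real (k div 2)) # laplacian_shifts d b (k div 2))"

lemma length_laplacian_shifts [simp]: "length (laplacian_shifts d b m) = 2 * m"
  by (induction m) auto

lemma length_nabla_shifts [simp]: "length (nabla_shifts d b k) = k"
  by (simp add: nabla_shifts_def)

text \<open>Every Laplacian raises the weight exponent by 2 and consumes two derivatives. The
  surplus smoothness \<open>k\<close> stays arbitrary so that the induction hypothesis leaves these
  two derivatives to \<open>g\<close>.\<close>

lemma laplacian_power_log_radial:
  fixes u :: "real^'n::finite \<Rightarrow> real"
  assumes "Ck_real (2 * m + k) f"
    and u: "\<And>x. x \<noteq> 0 \<Longrightarrow> u x = exp (b * neg_log_norm x) * f (neg_log_norm x)"
    and "x \<noteq> 0"
  shows "(laplacian ^^ m) u x = exp ((b + 2 * m) * neg_log_norm x) *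
    foldr shifted_deriv (laplacian_shifts (real CARD('n) - 2) b m) f (neg_log_norm x)"
  using assms(1,3)
proof (induction m arbitrary: x k)
  case 0
  then show ?case using u by simp
next
  case (Suc m)
  let ?b = "b + 2 * real m" and ?d = "real CARD('n) - 2"
  define g where "g = foldr shifted_deriv (laplacian_shifts ?d b m) f"
  have g: "Ck_real (Suc (Suc k)) g"
    unfolding g_def using Suc.prems(1) by (intro foldr_shifted_deriv_Ck_real) (simp add: add_ac)
  have g1: "Ck_real (Suc k) (shifted_deriv ?b g)"
    by (rule shifted_deriv_Ck_real[OF g])
  have IH: "(laplacian ^^ m) u y = exp (?b * neg_log_norm y) * g (neg_log_norm y)" if "y \<noteq> 0" for y
    using Suc.IH[of "Suc (Suc k)" y] Suc.prems(1) that by (simp add: g_def add_ac)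
  have W: "Ck_real 2 (\<lambda>t. exp (?b * t) * g t)"
    using Ck_real_mono[OF g, of 2] by (intro Ck_real_mult Ck_real_exp) simp
  have "(laplacian ^^ Suc m) u x = laplacian (\<lambda>x. exp (?b * neg_log_norm x) * g (neg_log_norm x)) x"
    using Suc.prems(2) IH by (auto intro: laplacian_cong_open[of "- {0}"])
  \<comment> \<open>With \<open>W' = exp (?b t) (D + ?b) g\<close>, the expression
    \<open>W'' - ?d W'\<close> factors as
    \<open>exp (?b t) (D + ?b - ?d) (D + ?b) g\<close>.\<close>
  also have "\<dots> = exp (2 * neg_log_norm x) * exp (?b * neg_log_norm x) *
      shifted_deriv (?b - ?d) (shifted_deriv ?b g) (neg_log_norm x)"
    unfolding laplacian_log_radial[OF W Suc.prems(2)] deriv_exp_mult[OF g] deriv_exp_mult[OF g1]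
    by (simp add: shifted_deriv_diff right_diff_distrib mult_ac)
  also have "exp (2 * neg_log_norm x) * exp (?b * neg_log_norm x) =
      exp ((b + 2 * Suc m) * neg_log_norm x)"
    by (simp add: algebra_simps flip: exp_add)
  finally show ?case by (simp add: g_def)
qed

lemma norm_nabla_log_radial:
  fixes u :: "real^'n::finite \<Rightarrow> real"
  assumes f: "Ck_real k f"
    and u: "\<And>x. x \<noteq> 0 \<Longrightarrow> u x = exp (b * neg_log_norm x) * f (neg_log_norm x)"
    and x: "x \<noteq> 0"
  shows "norm_nabla k u x = exp ((b + k) * neg_log_norm x) *
    \<bar>foldr shifted_deriv (nabla_shifts (real CARD('n) - 2) b k) f (neg_log_norm x)\<bar>"
proof (cases "even k")
  case True
  then have "real k = 2 * real (k div 2)"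
    by (metis dvd_mult_div_cancel of_nat_mult of_nat_numeral)
  then show ?thesis
    using laplacian_power_log_radial[of "k div 2" 0 f u b x] f u x True
    by (simp add: norm_nabla_def nabla_shifts_def abs_mult)
next
  case False
  define m where "m = k div 2"
  have k: "k = 2 * m + 1" using False by (simp add: m_def)
  let ?b = "b + 2 * real m" and ?d = "real CARD('n) - 2"
  define g where "g = foldr shifted_deriv (laplacian_shifts ?d b m) f"
  have g: "Ck_real (Suc 0) g"
    unfolding g_def using f k by (intro foldr_shifted_deriv_Ck_real) (simp add: add_ac)
  have W: "Ck_real (Suc 0) (\<lambda>t. exp (?b * t) * g t)"
    using g by (intro Ck_real_mult Ck_real_exp)
  have eq: "(laplacian ^^ m) u y = exp (?b * neg_log_norm y) * g (neg_log_norm y)" if "y \<noteq> 0" for y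
    using laplacian_power_log_radial[of m 1 f u b y] f u that k by (simp add: g_def)
  have "partial_deriv i ((laplacian ^^ m) u) x =
      partial_deriv i (\<lambda>x. exp (?b * neg_log_norm x) * g (neg_log_norm x)) x" for i
    by (rule partial_deriv_cong_open[of "- {0}"]) (use x eq in auto)
  then have "gradient ((laplacian ^^ m) u) x = gradient (\<lambda>x. exp (?b * neg_log_norm x) * g (neg_log_norm x)) x"
    by (simp add: gradient_def)
  then have "norm_nabla k u x = exp (neg_log_norm x) * exp (?b * neg_log_norm x) *
      \<bar>shifted_deriv ?b g (neg_log_norm x)\<bar>"
    using norm_gradient_log_radial[OF W x] False
    by (simp add: norm_nabla_def m_def[symmetric] deriv_exp_mult[OF g] abs_mult)
  also have "exp (neg_log_norm x) * exp (?b * neg_log_norm x) = exp ((b + k) * neg_log_norm x)"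
    by (simp add: k algebra_simps flip: exp_add)
  finally show ?thesis
    using False by (simp only: nabla_shifts_def g_def m_def if_False foldr.simps o_apply)
qed

section \<open>Correspondence between radial functions and profiles on the line\<close>

text \<open>A profile vanishing for \<open>|t| > A\<close> puts the support of \<open>u\<close> in
  the closed annulus \<open>exp (- A) <= |x| <= exp A\<close>, which is compact and avoids the
  origin.\<close>

lemma radial_Ck_compact_of_profile:
  fixes b :: real
  assumes f: "Ck_real k f" and "compactly_supported f"
  defines "u \<equiv> \<lambda>x::real^'n::finite. if x = 0 then 0 else exp (b * neg_log_norm x) * f (neg_log_norm x)"
  shows "u \<in> Ck_compact_radial k (UNIV - {0})"
proof -
  obtain A where A: "\<And>t. A < \<bar>t\<bar> \<Longrightarrow> f t = 0"
    using assms(2) by (auto simp: compactly_supported_def)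
  let ?K = "cball 0 (exp A) - ball 0 (exp (- A)) :: (real^'n) set"
  have "Ck_on k (UNIV - {0}) u \<longleftrightarrow>
      Ck_on k (UNIV - {0}) (\<lambda>x::real^'n. exp (b * neg_log_norm x) * f (neg_log_norm x))"
    by (rule Ck_on_cong) (auto simp: u_def)
  moreover have "Ck_on k (UNIV - {0}) (\<lambda>x::real^'n. exp (b * neg_log_norm x) * f (neg_log_norm x))"
    by (intro Ck_on_log_radial[of k "\<lambda>t. exp (b * t) * f t"] Ck_real_mult Ck_real_exp f)
  ultimately have Ck: "Ck_on k (UNIV - {0}) u"
    by blast
  have "{x. u x \<noteq> 0} \<subseteq> ?K"
  proof
    fix x assume "x \<in> {x. u x \<noteq> 0}"
    then have "x \<noteq> 0" "\<bar>ln (norm x)\<bar> \<le> A"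
      using A[of "neg_log_norm x"] by (auto simp: u_def neg_log_norm_def not_less[symmetric] split: if_splits)
    then have "- A \<le> ln (norm x)" "ln (norm x) \<le> A" "norm x > 0"
      by auto
    then have "exp (- A) \<le> norm x" "norm x \<le> exp A"
      by (metis exp_le_cancel_iff exp_ln)+
    then show "x \<in> ?K" by simp
  qed
  moreover have K: "compact ?K"
    by (intro compact_diff compact_cball open_ball)
  ultimately have sub: "closure {x. u x \<noteq> 0} \<subseteq> ?K"
    by (intro closure_minimal compact_imp_closed)
  moreover from this have "compact (closure {x. u x \<noteq> 0})"
    by (meson K bounded_subset closed_closure compact_eq_bounded_closed)
  moreover have "?K \<subseteq> UNIV - {0}"
    by auto
  moreover have "radially_symmetric u"
    by (auto simp: radially_symmetric_def u_def neg_log_norm_def)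
  ultimately show ?thesis
    using Ck unfolding Ck_compact_radial_def Ck_compact_def by blast
qed

text \<open>By radial symmetry \<open>u\<close> is determined by its values on one coordinate ray.
  Its support stays within a radius \<open>R\<close> and outside a radius \<open>\<delta>\<close>,
  which bounds \<open>t\<close> on both sides.\<close>

lemma profile_of_radial_Ck_compact:
  fixes u :: "real^'n::finite \<Rightarrow> real" and b :: real
  assumes "u \<in> Ck_compact_radial k (UNIV - {0})"
  obtains f where "Ck_real k f" "compactly_supported f"
    "\<And>x. x \<noteq> 0 \<Longrightarrow> u x = exp (b * neg_log_norm x) * f (neg_log_norm x)"
proof -
  fix i :: 'n
  let ?e = "axis i 1 :: real^'n"
  define f where "f t = exp (- b * t) * u (exp (- t) *\<^sub>R ?e)" for t
  have u: "Ck_on k (UNIV - {0}) u" "compact (closure {x. u x \<noteq> 0})" "0 \<notin> closure {x. u x \<noteq> 0}"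
      "\<And>x y. norm x = norm y \<Longrightarrow> u x = u y"
    using assms unfolding Ck_compact_radial_def Ck_compact_def radially_symmetric_def by blast+
  have "Ck_real k f"
    unfolding f_def [abs_def] by (intro Ck_real_mult Ck_real_exp Ck_real_ray u)
  moreover have "u x = exp (b * neg_log_norm x) * f (neg_log_norm x)" if "x \<noteq> 0" for x
  proof -
    have "u x = u (exp (- neg_log_norm x) *\<^sub>R ?e)"
      using that by (intro u(4)) (simp add: neg_log_norm_def)
    then show ?thesis
      by (simp add: f_def flip: exp_add mult.assoc)
  qed
  moreover have "compactly_supported f"
  proof -
    obtain R where R: "R > 0" "\<And>x. u x \<noteq> 0 \<Longrightarrow> norm x \<le> R"
      using compact_imp_bounded[OF u(2)] closure_subset[of "{x. u x \<noteq> 0}"]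
      by (auto simp: bounded_pos)
    have "open (- closure {x. u x \<noteq> 0})"
      by (simp add: open_Compl)
    then obtain \<delta> where d: "\<delta> > 0" "\<And>y. dist y 0 < \<delta> \<Longrightarrow> y \<in> - closure {x. u x \<noteq> 0}"
      using u(3) unfolding open_dist by (metis ComplI)
    have d': "norm x \<ge> \<delta>" if "u x \<noteq> 0" for x
      using d(2)[of x] closure_subset[of "{x. u x \<noteq> 0}"] that by force
    have "f t = 0" if t: "max \<bar>ln R\<bar> \<bar>ln \<delta>\<bar> < \<bar>t\<bar>" for t
    proof (rule ccontr)
      assume "f t \<noteq> 0"
      then have "\<delta> \<le> exp (- t)" "exp (- t) \<le> R"
        using R(2)[of "exp (- t) *\<^sub>R ?e"] d'[of "exp (- t) *\<^sub>R ?e"] by (auto simp: f_def)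
      then have "ln \<delta> \<le> - t" "- t \<le> ln R"
        using d(1) R(1) by (metis exp_gt_zero ln_exp ln_le_cancel_iff)+
      then show False using t by linarith
    qed
    then show ?thesis unfolding compactly_supported_def by blast
  qed
  ultimately show thesis using that by blast
qed

text \<open>The choice of \<open>b\<close> makes both integrands \<open>exp (n t)\<close> times an
  unweighted p-th power. Both sides then carry the same positive constant \<open>C\<close>, which
  cancels.\<close>

lemma admissible_constant_iff_profile:
  fixes \<alpha> p c :: real and k :: nat
  assumes p: "p > 1"
  defines "b \<equiv> (real CARD('n::finite) + \<alpha>) / p - real k"
  shows "admissible_constant TYPE('n) \<alpha> k p c \<longleftrightarrow> 0 \<le> c \<and>
    (\<forall>f. Ck_real k f \<longrightarrow> compactly_supported f \<longrightarrow> c * (LINT t|lborel. \<bar>f t\<bar> powr p)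
      \<le> (LINT t|lborel. \<bar>foldr shifted_deriv (nabla_shifts (real CARD('n) - 2) b k) f t\<bar> powr p))"
proof -
  let ?F = "foldr shifted_deriv (nabla_shifts (real CARD('n) - 2) b k)"
  define C where "C = real CARD('n) * unit_ball_vol CARD('n)"
  have C: "C > 0" by (simp add: C_def)
  have bp: "b * p = real CARD('n) + \<alpha> - real k * p"
    using p by (simp add: b_def field_simps)
  have int: "(LINT x|lborel. norm x powr \<alpha> * norm_nabla k u x powr p) =
        C * (LINT t|lborel. \<bar>?F f t\<bar> powr p)" (is ?nabla)
      "(LINT x|lborel. norm x powr (\<alpha> - real k * p) * \<bar>u x\<bar> powr p) =
        C * (LINT t|lborel. \<bar>f t\<bar> powr p)" (is ?zero)
    if f: "Ck_real k f" and u: "\<And>x. x \<noteq> 0 \<Longrightarrow> u x = exp (b * neg_log_norm x) * f (neg_log_norm x)"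
    for f and u :: "real^'n \<Rightarrow> real"
  proof -
    have powr_exp: "norm x powr q = exp (- q * neg_log_norm x)" if "x \<noteq> 0" for x :: "real^'n" and q
      using exp_neg_log_norm[OF that, of "- q"] by simp
    have cont: "continuous_on UNIV (\<lambda>t. \<bar>g t\<bar> powr p)" if "continuous_on UNIV g" for g :: "real \<Rightarrow> real"
      using p by (intro continuous_on_powr' continuous_intros that) auto
    show ?nabla
      unfolding C_def
    proof (rule trans[OF integral_log_radial[where g = "\<lambda>t. \<bar>?F f t\<bar> powr p"]])
      fix x :: "real^'n" assume x: "x \<noteq> 0"
      let ?T = "neg_log_norm x"
      \<comment> \<open>By \<open>bp\<close> the coefficient \<open>b * p - \<alpha> + k * p\<close>
        is the dimension, exactly the exponent that the measure absorbs.\<close>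
      have "- \<alpha> * ?T + (b + k) * ?T * p = (b * p - \<alpha> + k * p) * ?T"
        by (simp add: algebra_simps)
      then have e: "exp (- \<alpha> * ?T) * exp ((b + k) * ?T * p) = exp (DIM(real^'n) * ?T)"
        unfolding bp exp_add[symmetric] by simp
      have nabla: "norm_nabla k u x = exp ((b + k) * ?T) * \<bar>?F f ?T\<bar>"
        by (rule norm_nabla_log_radial[OF f _ x]) (rule u)
      show "norm x powr \<alpha> * norm_nabla k u x powr p =
          exp (DIM(real^'n) * ?T) * \<bar>?F f ?T\<bar> powr p"
        unfolding e[symmetric] nabla powr_exp[OF x]
        by (simp only: powr_mult abs_ge_zero exp_ge_zero exp_powr_real mult.assoc)
    qed (use foldr_shifted_deriv_Ck_real[of 0 _ f] f in \<open>auto intro!: cont\<close>)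
    show ?zero
      unfolding C_def
    proof (rule trans[OF integral_log_radial[where g = "\<lambda>t. \<bar>f t\<bar> powr p"]])
      fix x :: "real^'n" assume x: "x \<noteq> 0"
      let ?T = "neg_log_norm x"
      have "- (\<alpha> - k * p) * ?T + b * ?T * p = (b * p - \<alpha> + k * p) * ?T"
        by (simp add: algebra_simps)
      then have e: "exp (- (\<alpha> - k * p) * ?T) * exp (b * ?T * p) = exp (DIM(real^'n) * ?T)"
        unfolding bp exp_add[symmetric] by simp
      show "norm x powr (\<alpha> - real k * p) * \<bar>u x\<bar> powr p =
          exp (DIM(real^'n) * ?T) * \<bar>f ?T\<bar> powr p"
        unfolding e[symmetric] u[OF x] powr_exp[OF x] abs_mult abs_exp_cancel
        by (simp only: powr_mult abs_ge_zero exp_ge_zero exp_powr_real mult.assoc)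
    qed (use Ck_real_continuous[OF f] in \<open>auto intro!: cont\<close>)
  qed
  show ?thesis
    unfolding admissible_constant_def
  proof (intro conj_cong refl iffI allI impI)
    fix f
    assume *: "\<forall>u::real^'n \<Rightarrow> real. u \<in> Ck_compact_radial k (UNIV - {0}) \<longrightarrow>
        c * (LINT x|lborel. norm x powr (\<alpha> - real k * p) * \<bar>u x\<bar> powr p)
        \<le> (LINT x|lborel. norm x powr \<alpha> * norm_nabla k u x powr p)"
      and f: "Ck_real k f" "compactly_supported f"
    define u where "u x = (if x = 0 then 0 else exp (b * neg_log_norm x) * f (neg_log_norm x))"
      for x :: "real^'n"
    have u: "u \<in> Ck_compact_radial k (UNIV - {0})"
      using radial_Ck_compact_of_profile[OF f, of b] unfolding u_def [abs_def] .
    have u_eq: "u x = exp (b * neg_log_norm x) * f (neg_log_norm x)" if "x \<noteq> 0" for x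
      using that by (simp add: u_def)
    have "C * (c * (LINT t|lborel. \<bar>f t\<bar> powr p)) \<le> C * (LINT t|lborel. \<bar>?F f t\<bar> powr p)"
      using *[rule_format, OF u] by (simp add: int[OF f(1) u_eq] mult.left_commute)
    then show "c * (LINT t|lborel. \<bar>f t\<bar> powr p) \<le> (LINT t|lborel. \<bar>?F f t\<bar> powr p)"
      using C by simp
  next
    fix u :: "real^'n \<Rightarrow> real"
    assume *: "\<forall>f. Ck_real k f \<longrightarrow> compactly_supported f \<longrightarrow>
        c * (LINT t|lborel. \<bar>f t\<bar> powr p) \<le> (LINT t|lborel. \<bar>?F f t\<bar> powr p)"
      and "u \<in> Ck_compact_radial k (UNIV - {0})"
    then obtain f where f: "Ck_real k f" "compactly_supported f"
      "\<And>x. x \<noteq> 0 \<Longrightarrow> u x = exp (b * neg_log_norm x) * f (neg_log_norm x)"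
      using profile_of_radial_Ck_compact by blast
    have "C * (c * (LINT t|lborel. \<bar>f t\<bar> powr p)) \<le> C * (LINT t|lborel. \<bar>?F f t\<bar> powr p)"
      using * f C by (intro mult_left_mono) auto
    then show "c * (LINT x|lborel. norm x powr (\<alpha> - real k * p) * \<bar>u x\<bar> powr p)
        \<le> (LINT x|lborel. norm x powr \<alpha> * norm_nabla k u x powr p)"
      using int[OF f(1,3)] by (simp add: mult.left_commute)
  qed
qed

section \<open>Evaluation of the best constant\<close>

lemma best_constant_eq_prod_nabla_shifts:
  fixes \<alpha> p :: real and k :: nat
  assumes p: "p > 1"
  defines "b \<equiv> (real CARD('n::finite) + \<alpha>) / p - real k"
  shows "is_best_constant TYPE('n) \<alpha> k p (\<bar>prod_list (nabla_shifts (real CARD('n) - 2) b k)\<bar> powr p)"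
proof -
  have "admissible_constant TYPE('n) \<alpha> k p (\<bar>prod_list (nabla_shifts (real CARD('n) - 2) b k)\<bar> powr p)"
    unfolding admissible_constant_iff_profile[OF p] b_def
    using p by (auto intro!: integral_foldr_shifted_deriv_ge)
  moreover have "c \<le> \<bar>prod_list (nabla_shifts (real CARD('n) - 2) b k)\<bar> powr p"
    if "admissible_constant TYPE('n) \<alpha> k p c" for c
    using that p unfolding admissible_constant_iff_profile[OF p] b_def
    by (intro foldr_shifted_deriv_constant_sharp) auto
  ultimately show ?thesis by (simp add: is_best_constant_def)
qed

lemma prod_list_laplacian_shifts:
  "prod_list (laplacian_shifts d b m) = (\<Prod>j<m. (b + 2 * real j - d) * (b + 2 * real j))"
  by (induction m) (simp_all add: mult_ac)

text \<open>\<open>m\<close> counts the Laplacians and \<open>e\<close> is the parity of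
  \<open>k\<close>. Each pair of shifts agrees with one \<open>rellich_gamma\<close> up to a sign,
  which the absolute values remove.\<close>

lemma abs_prod_laplacian_shifts:
  assumes "b = (real n + \<alpha>) / p - 2 * real m - real e"
  shows "\<bar>prod_list (laplacian_shifts (real n - 2) b m)\<bar> =
    (\<Prod>h=1..m. \<bar>rellich_gamma n p \<alpha> (2 * h + e)\<bar>)"
proof -
  have "\<bar>prod_list (laplacian_shifts (real n - 2) b m)\<bar> =
      (\<Prod>j<m. \<bar>(b + 2 * real j - (real n - 2)) * (b + 2 * real j)\<bar>)"
    by (simp add: prod_list_laplacian_shifts abs_prod)
  also have "\<dots> = (\<Prod>h=1..m. \<bar>rellich_gamma n p \<alpha> (2 * h + e)\<bar>)"
  \<comment> \<open>The shifts grow with \<open>j\<close>, while the index \<open>2 * h + e\<close>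
    is subtracted in \<open>rellich_gamma\<close>; hence the reversal \<open>h = m - j\<close> from
    \<open>{..<m}\<close> onto \<open>{1..m}\<close>.\<close>
  proof (rule prod.reindex_bij_witness[where i = "\<lambda>h. m - h" and j = "\<lambda>j. m - j"])
    fix j assume "j \<in> {..<m}"
    then have "real (m - j) = real m - real j" by (simp add: of_nat_diff)
    then have "b + 2 * real j = (real n + \<alpha>) / p - real (2 * (m - j) + e)"
      using assms by simp
    then have "rellich_gamma n p \<alpha> (2 * (m - j) + e) = (b + 2 * real j) * - (b + 2 * real j - (real n - 2))"
      unfolding rellich_gamma_def by simp
    then show "\<bar>rellich_gamma n p \<alpha> (2 * (m - j) + e)\<bar> =
        \<bar>(b + 2 * real j - (real n - 2)) * (b + 2 * real j)\<bar>"
      by (simp only: abs_mult abs_minus_cancel mult.commute)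
  qed auto
  finally show ?thesis .
qed

lemma is_best_constant_unique:
  "is_best_constant T \<alpha> k p c \<Longrightarrow> is_best_constant T \<alpha> k p c' \<Longrightarrow> c = c'"
  by (auto simp: is_best_constant_def intro: antisym)

theorem theorem1p1:
  fixes \<alpha> p c :: real and k :: nat
  assumes "CARD('n::finite) \<ge> 2" and "p > 1" and "k \<ge> 2"
  shows "is_best_constant TYPE('n) \<alpha> k p c \<longleftrightarrow>
    c = (if even k
         then (\<Prod>h=1..k div 2. \<bar>rellich_gamma CARD('n) p \<alpha> (2 * h)\<bar> powr p)
         else \<bar>hardy_H CARD('n) p \<alpha>\<bar> powr p *
              (\<Prod>h=1..k div 2. \<bar>rellich_gamma CARD('n) p \<alpha> (2 * h + 1)\<bar> powr p))"
    (is "_ \<longleftrightarrow> c = ?c")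
proof -
  let ?b = "(real CARD('n) + \<alpha>) / p - real k"
  have "\<bar>prod_list (nabla_shifts (real CARD('n) - 2) ?b k)\<bar> powr p = ?c"
  proof (cases "even k")
    case True
    then have "real k = 2 * real (k div 2)"
      by (metis dvd_mult_div_cancel of_nat_mult of_nat_numeral)
    then show ?thesis
      using True abs_prod_laplacian_shifts[of ?b "CARD('n)" \<alpha> p "k div 2" 0]
      by (simp add: nabla_shifts_def prod_powr_distrib)
  next
    case False
    then have k: "real k = 2 * real (k div 2) + 1"
      by (metis odd_two_times_div_two_succ of_nat_1 of_nat_add of_nat_mult of_nat_numeral)
    \<comment> \<open>The shift of the gradient is \<open>(n + \<alpha>) / p - 1\<close>, the source
      of the Hardy factor.\<close>
    then have "?b + 2 * real (k div 2) = hardy_H CARD('n) p \<alpha>"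
      by (simp add: hardy_H_def)
    then show ?thesis
      using False k abs_prod_laplacian_shifts[of ?b "CARD('n)" \<alpha> p "k div 2" 1]
      by (simp add: nabla_shifts_def prod_powr_distrib abs_mult powr_mult prod_nonneg)
  qed
  with best_constant_eq_prod_nabla_shifts[OF assms(2), where 'n = 'n and \<alpha> = \<alpha> and k = k]
  have "is_best_constant TYPE('n) \<alpha> k p ?c" by simp
  then show ?thesis
    using is_best_constant_unique by blast
qed

end
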